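(* Fix $k\ge 3$. Then, as $N\to\infty$, \[ f_k(N)\ge (\log N)^{\log\mu_k^{\mathrm S}-o(1)}; \] that is, for every $\varepsilon>0$, $f_k(N)\ge(\log N)^{\log\mu_k^{\mathrm S}-\varepsilon}$ for all sufficiently large $N$.
   Context: For integers $k\ge 3$ and $N\ge1$, a set $A\subseteq\{1,\dots,N\}$ is LCM-$k$-free if it does not contain distinct $a_1,\dots,a_k$ such that $\operatorname{lcm}(a_i,a_j)$ is the same for all $1\le i<j\le k$; $f_k(N):=\max\{\sum_{a\in A}1/a : A\subseteq\{1,\dots,N\}\text{ LCM-}k\text{-free}\}$. A collection of $k$ distinct sets $S_1,\dots,S_k$ is a $k$-sunflower if $S_i\cap S_j=S_1\cap S_2$ for all $1\le i<j\le k$; a family is $k$-sunflower-free if no $k$ distinct members form a $k$-sunflower. $F_k(n)$ is the maximum size of a $k$-sunflower-free family $\mathcal F\subseteq 2^{[n]}$, and $\mu_k^{\mathrm S}:=\limsup_{n\to\infty}F_k(n)^{1/n}$. $\log$ is the natural logarithm. *)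

theory Defs
  imports "HOL-Analysis.Analysis"
begin

definition lcm_free :: "nat \<Rightarrow> nat set \<Rightarrow> bool" where
  "lcm_free k A \<longleftrightarrow>
     \<not> (\<exists>a :: nat \<Rightarrow> nat. inj_on a {1..k} \<and> a ` {1..k} \<subseteq> A \<and>
          (\<exists>m. \<forall>i j. 1 \<le> i \<and> i < j \<and> j \<le> k \<longrightarrow> lcm (a i) (a j) = m))"

definition f_lcm :: "nat \<Rightarrow> nat \<Rightarrow> real" where
  "f_lcm k N = Max {(\<Sum>a\<in>A. 1 / real a) | A. A \<subseteq> {1..N} \<and> lcm_free k A}"

definition is_sunflower :: "nat \<Rightarrow> (nat \<Rightarrow> 'a set) \<Rightarrow> bool" where
  "is_sunflower k S \<longleftrightarrow> inj_on S {1..k} \<and>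
     (\<forall>i j. 1 \<le> i \<and> i < j \<and> j \<le> k \<longrightarrow> S i \<inter> S j = S 1 \<inter> S 2)"

definition sunflower_free :: "nat \<Rightarrow> 'a set set \<Rightarrow> bool" where
  "sunflower_free k \<F> \<longleftrightarrow> \<not> (\<exists>S. S ` {1..k} \<subseteq> \<F> \<and> is_sunflower k S)"

definition F_sun :: "nat \<Rightarrow> nat \<Rightarrow> nat" where
  "F_sun k n = Max {card \<F> | \<F>. \<F> \<subseteq> Pow {1..n} \<and> sunflower_free k \<F>}"

(* The library's limsup lives in complete lattices, hence the detour through ereal;
   ereal_mu_sun below shows that the projection back to the reals loses nothing. *)
definition mu_sun :: "nat \<Rightarrow> real" where
  "mu_sun k = real_of_ereal (limsup (\<lambda>n. ereal (root n (real (F_sun k n)))))"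

lemma f_lcm_candidates:
  assumes "k \<ge> 1"
  shows "finite {(\<Sum>a\<in>A. 1 / real a) | A. A \<subseteq> {1..N} \<and> lcm_free k A}"
    and "{(\<Sum>a\<in>A. 1 / real a) | A. A \<subseteq> {1..N} \<and> lcm_free k A} \<noteq> {}"
proof -
  have "{(\<Sum>a\<in>A. 1 / real a) | A. A \<subseteq> {1..N} \<and> lcm_free k A}
      \<subseteq> (\<lambda>A. \<Sum>a\<in>A. 1 / real a) ` Pow {1..N}"
    by auto
  then show "finite {(\<Sum>a\<in>A. 1 / real a) | A. A \<subseteq> {1..N} \<and> lcm_free k A}"
    by (rule finite_subset) simp
  have "lcm_free k {}"
    using assms by (auto simp: lcm_free_def)
  then show "{(\<Sum>a\<in>A. 1 / real a) | A. A \<subseteq> {1..N} \<and> lcm_free k A} \<noteq> {}"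
    by blast
qed

lemma F_sun_candidates_finite:
  fixes n :: nat
  shows "finite {card \<F> | \<F>. \<F> \<subseteq> Pow {1..n} \<and> sunflower_free k \<F>}"
proof -
  have "{card \<F> | \<F>. \<F> \<subseteq> Pow {1..n} \<and> sunflower_free k \<F>} \<subseteq> card ` Pow (Pow {1..n})"
    by auto
  then show ?thesis
    by (rule finite_subset) simp
qed

lemma sunflower_free_singleton:
  assumes "k \<ge> 2"
  shows "sunflower_free k {X}"
proof -
  have False if "S ` {1..k} \<subseteq> {X}" "inj_on S {1..k}" for S
  proof -
    have "S 1 \<in> S ` {1..k}" "S 2 \<in> S ` {1..k}" using assms by simp_all
    then have "S 1 = X" "S 2 = X" using that(1) by blast+
    then show False using assms inj_onD[OF that(2), of 1 2] by simp
  qed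
  then show ?thesis unfolding sunflower_free_def is_sunflower_def by blast
qed

lemma F_sun_bounds:
  assumes "k \<ge> 2"
  shows "1 \<le> F_sun k n" and "F_sun k n \<le> 2 ^ n"
proof -
  let ?C = "{card \<F> | \<F>. \<F> \<subseteq> Pow {1..n} \<and> sunflower_free k \<F>}"
  have "card {{} :: nat set} \<in> ?C"
    using sunflower_free_singleton[OF assms, of "{} :: nat set"] by blast
  then have one: "1 \<in> ?C" by simp
  then show "1 \<le> F_sun k n"
    unfolding F_sun_def using F_sun_candidates_finite by (intro Max_ge)
  have "card \<F> \<le> 2 ^ n" if "\<F> \<subseteq> Pow {1..n}" for \<F> :: "nat set set"
    using card_mono[OF _ that] by (simp add: card_Pow)
  then show "F_sun k n \<le> 2 ^ n"
    unfolding F_sun_def using one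
    by (intro Max.boundedI F_sun_candidates_finite) auto
qed

lemma
  assumes "k \<ge> 2"
  shows ereal_mu_sun: "ereal (mu_sun k) = limsup (\<lambda>n. ereal (root n (real (F_sun k n))))"
    and mu_sun_bounds: "1 \<le> mu_sun k" "mu_sun k \<le> 2"
proof -
  let ?L = "limsup (\<lambda>n. ereal (root n (real (F_sun k n))))"
  have b: "1 \<le> root n (real (F_sun k n)) \<and> root n (real (F_sun k n)) \<le> 2" if "n > 0" for n
  proof -
    have "real (F_sun k n) \<le> 2 ^ n"
      using F_sun_bounds(2)[OF assms, of n] by (simp flip: of_nat_le_iff)
    then have "root n (real (F_sun k n)) \<le> root n (2 ^ n)"
      using that by simp
    then show ?thesis
      using that F_sun_bounds(1)[OF assms, of n] by (simp add: real_root_power_cancel)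
  qed
  have lo: "1 \<le> ?L"
  proof -
    have "1 \<le> liminf (\<lambda>n. ereal (root n (real (F_sun k n))))"
      using b by (intro Liminf_bounded eventually_mono[OF eventually_gt_at_top[of 0]]) auto
    also have "\<dots> \<le> ?L" by (intro Liminf_le_Limsup) simp
    finally show ?thesis .
  qed
  have hi: "?L \<le> 2"
    using b by (intro Limsup_bounded eventually_mono[OF eventually_gt_at_top[of 0]]) auto
  show eq: "ereal (mu_sun k) = ?L"
    unfolding mu_sun_def using lo hi by (cases ?L) auto
  show "1 \<le> mu_sun k" "mu_sun k \<le> 2"
    using lo hi unfolding eq[symmetric] by auto
qed

end

theory Submission
  imports Defs "HOL-Computational_Algebra.Primes"
begin

text \<open>
  Squarefree numbers are sets of primes and their lcm is the union, so a family of sets without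
  \<open>k\<close> members having equal pairwise unions (the complements of a sunflower-free family)
  gives LCM-\<open>k\<close>-free numbers. Fix \<open>n\<close> and a sunflower-free family on \<open>{1..n}\<close> of size nearly
  \<open>\<mu> ^ n\<close>, all of whose members have the same size, which costs only a factor \<open>n + 1\<close>. Split the
  primes up to \<open>x\<close> greedily into groups of reciprocal sum slightly above 1; as the reciprocals of
  the primes up to \<open>x\<close> sum to at least \<open>ln (ln x) - 1\<close>, there are about \<open>ln (ln x)\<close> groups. Bundle
  the groups into blocks of \<open>n\<close>, and in each block choose a complement \<open>S\<close> of a member of the family
  and one prime from each group indexed by \<open>S\<close>. The products of all chosen primes form an
  LCM-\<open>k\<close>-free set with reciprocal sum at least about \<open>\<mu>\<close> to the number of groups. A product of
  \<open>g\<close> primes is at most \<open>x ^ g\<close>, so \<open>ln x = (ln N) powr (1 - \<delta>)\<close> keeps these numbers below \<open>N\<close>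
  while \<open>ln (ln x) = (1 - \<delta>) * ln (ln N)\<close>.
\<close>

section \<open>Reciprocals of primes\<close>

text \<open>One half of Euler's product formula, kept finite by the cutoff \<open>n\<close>. If
  \<open>p * j\<close> is counted for \<open>insert p P\<close>, so is \<open>j\<close>; hence
  \<open>h (insert p P) \<le> h P + 1 / p * h (insert p P)\<close>, and solving for the left side
  yields one more Euler factor.\<close>

lemma sum_inverse_smooth_le:
  fixes P :: "nat set"
  assumes "finite P" "\<And>p. p \<in> P \<Longrightarrow> prime p"
  shows "(\<Sum>m | m \<in> {1..n} \<and> prime_factors m \<subseteq> P. 1 / real m) \<le> (\<Prod>p\<in>P. 1 / (1 - 1 / real p))"
  using assms
proof (induction P rule: finite_induct)
  case empty
  have "{m. m \<in> {1..n} \<and> prime_factors m \<subseteq> {}} \<subseteq> {1}"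
    by (auto simp: prime_factorization_empty_iff)
  then have "(\<Sum>m | m \<in> {1..n} \<and> prime_factors m \<subseteq> {}. 1 / real m) \<le> (\<Sum>m\<in>{1}. 1 / real m)"
    by (intro sum_mono2) auto
  then show ?case by simp
next
  case (insert p P)
  define H where "H R = {m. m \<in> {1..n} \<and> prime_factors m \<subseteq> R}" for R
  define h where "h R = (\<Sum>m\<in>H R. 1 / real m)" for R
  have fin: "finite (H R)" for R by (simp add: H_def)
  have p: "prime p" using insert.prems by simp
  then have p1: "real p > 1" using prime_gt_1_nat by force
  have sub: "H (insert p P) \<subseteq> H P \<union> (\<lambda>m. p * m) ` H (insert p P)"
  proof
    fix m assume m: "m \<in> H (insert p P)"
    show "m \<in> H P \<union> (\<lambda>m. p * m) ` H (insert p P)"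
    proof (cases "p dvd m")
      case True
      then obtain j where j: "m = p * j" by blast
      have "j \<noteq> 0" "j \<le> m" using m j by (auto simp: H_def)
      moreover have "prime_factors j \<subseteq> prime_factors m"
        using m j by (intro dvd_prime_factors) (auto simp: H_def)
      ultimately have "j \<in> H (insert p P)" using m by (auto simp: H_def)
      then show ?thesis using j by blast
    next
      case False
      then have "p \<notin> prime_factors m" by (simp add: in_prime_factors_iff)
      then show ?thesis using m by (auto simp: H_def)
    qed
  qed
  have "h (insert p P) \<le> (\<Sum>m\<in>H P \<union> (\<lambda>m. p * m) ` H (insert p P). 1 / real m)"
    unfolding h_def by (intro sum_mono2 sub) (auto simp: fin)
  also have "\<dots> \<le> h P + (\<Sum>m\<in>(\<lambda>m. p * m) ` H (insert p P). 1 / real m)"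
    unfolding h_def using sum_nonneg[of "H P \<inter> (\<lambda>m. p * m) ` H (insert p P)" "\<lambda>m. 1 / real m"]
    by (subst sum_Un) (auto simp: fin)
  also have "(\<Sum>m\<in>(\<lambda>m. p * m) ` H (insert p P). 1 / real m) = 1 / real p * h (insert p P)"
    unfolding h_def using p1 by (subst sum.reindex) (auto simp: inj_on_def sum_distrib_left)
  finally have "h (insert p P) * (1 - 1 / real p) \<le> h P" by (simp add: algebra_simps)
  then have "h (insert p P) \<le> 1 / (1 - 1 / real p) * h P"
    using p1 by (simp add: field_simps)
  also have "\<dots> \<le> 1 / (1 - 1 / real p) * (\<Prod>p\<in>P. 1 / (1 - 1 / real p))"
    using insert p1 unfolding h_def H_def by (intro mult_left_mono) auto
  also have "\<dots> = (\<Prod>p\<in>insert p P. 1 / (1 - 1 / real p))" using insert by simp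
  finally show ?case unfolding h_def H_def .
qed

text \<open>Numbers up to \<open>n\<close> factor over primes up to \<open>n\<close>, so the Euler
  product dominates the harmonic sum and thus \<open>ln (n + 1)\<close>. After taking logarithms,
  \<open>p\<close> contributes \<open>1 / p\<close> plus an excess of at most
  \<open>1 / (p - 1) - 1 / p\<close>; extended to all integers from 2 to \<open>n\<close>, these
  excesses telescope to at most 1.\<close>

lemma sum_inverse_primes_ge:
  assumes "n \<ge> 1"
  shows "ln (ln (real n + 1)) - 1 \<le> (\<Sum>p | prime p \<and> p \<le> n. 1 / real p)"
proof -
  let ?P = "{p. prime p \<and> p \<le> n}"
  have fin: "finite ?P" by simp
  have gt1: "real p > 1" if "p \<in> ?P" for p using that prime_gt_1_nat by force
  have pos: "ln (real n + 1) > 0" using assms by simp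
  have "{m. m \<in> {1..n} \<and> prime_factors m \<subseteq> ?P} = {1..n}"
    by (auto simp: in_prime_factors_iff dest!: dvd_imp_le)
  then have "harm n \<le> (\<Prod>p\<in>?P. 1 / (1 - 1 / real p))"
    using sum_inverse_smooth_le[OF fin, of n] by (simp add: harm_def inverse_eq_divide)
  then have "ln (real n + 1) \<le> (\<Prod>p\<in>?P. 1 / (1 - 1 / real p))"
    using ln_le_harm[of n] by linarith
  then have "ln (ln (real n + 1)) \<le> ln (\<Prod>p\<in>?P. 1 / (1 - 1 / real p))"
    using pos by (intro ln_mono)
  also have "\<dots> = (\<Sum>p\<in>?P. ln (1 / (1 - 1 / real p)))"
    using gt1 by (intro ln_prod) (auto simp: less_imp_neq)
  also have "\<dots> \<le> (\<Sum>p\<in>?P. 1 / real p + (1 / (real p - 1) - 1 / real p))"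
  proof (intro sum_mono)
    fix p assume "p \<in> ?P"
    then have p: "real p > 1" by (rule gt1)
    then have "ln (1 / (1 - 1 / real p)) \<le> 1 / (1 - 1 / real p) - 1"
      by (intro ln_le_minus_one) auto
    also have "\<dots> = 1 / (real p - 1)" using p by (simp add: field_simps)
    finally show "ln (1 / (1 - 1 / real p)) \<le> 1 / real p + (1 / (real p - 1) - 1 / real p)" by simp
  qed
  also have "\<dots> = (\<Sum>p\<in>?P. 1 / real p) + (\<Sum>p\<in>?P. 1 / (real p - 1) - 1 / real p)"
    by (rule sum.distrib)
  also have "(\<Sum>p\<in>?P. 1 / (real p - 1) - 1 / real p) \<le> (\<Sum>m=2..n. 1 / (real m - 1) - 1 / real m)"
    by (intro sum_mono2) (auto dest: prime_ge_2_nat simp: field_simps)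
  also have "\<dots> = 1 - 1 / real n"
    using assms by (induction n rule: dec_induct) auto
  also have "\<dots> \<le> 1" by simp
  finally show ?thesis by simp
qed

section \<open>Greedy splitting into groups of weight about 1\<close>

text \<open>Points are added one by one; the first total to reach 1 overshoots by at most the weight
  of the last point.\<close>

lemma ex_subset_sum_between:
  fixes w :: "'a \<Rightarrow> real"
  assumes "finite Q" "\<And>x. x \<in> Q \<Longrightarrow> w x \<le> \<delta>" "1 \<le> sum w Q" "0 \<le> \<delta>"
  shows "\<exists>P\<subseteq>Q. 1 \<le> sum w P \<and> sum w P \<le> 1 + \<delta>"
  using assms
proof (induction Q rule: finite_induct)
  case (insert x Q)
  show ?case
  proof (cases "1 \<le> sum w Q")
    case True
    then obtain P where "P \<subseteq> Q" "1 \<le> sum w P \<and> sum w P \<le> 1 + \<delta>"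
      using insert.IH insert.prems by auto
    then show ?thesis by (meson subset_insertI2)
  next
    case False
    then have "sum w (insert x Q) \<le> 1 + \<delta>" using insert.prems(1)[of x] insert.hyps by simp
    then show ?thesis using insert.prems by blast
  qed
qed auto

text \<open>The upper bound on the weight used so far carries the induction, since it leaves enough
  for another group. The later induction over blocks relies on it as well.\<close>

lemma ex_disjoint_subsets_sum_ge_1:
  fixes w :: "'a \<Rightarrow> real"
  assumes "finite Q" "\<And>x. x \<in> Q \<Longrightarrow> w x \<le> \<delta>" "0 \<le> \<delta>" "(1 + \<delta>) * real n \<le> sum w Q"
  shows "\<exists>P. disjoint_family_on P {1..n} \<and> (\<forall>i\<in>{1..n}. P i \<subseteq> Q \<and> 1 \<le> sum w (P i)) \<and>
             sum w (\<Union>i\<in>{1..n}. P i) \<le> (1 + \<delta>) * real n"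
  using assms(4)
proof (induction n)
  case 0
  then show ?case by (auto simp: disjoint_family_on_def)
next
  case (Suc n)
  then have "(1 + \<delta>) * real n \<le> sum w Q" using assms(3) by (simp add: algebra_simps)
  then obtain P where P: "disjoint_family_on P {1..n}" "\<forall>i\<in>{1..n}. P i \<subseteq> Q \<and> 1 \<le> sum w (P i)"
    "sum w (\<Union>i\<in>{1..n}. P i) \<le> (1 + \<delta>) * real n" using Suc.IH by blast
  let ?U = "\<Union>i\<in>{1..n}. P i"
  have U: "?U \<subseteq> Q" using P by blast
  have "sum w (Q - ?U) = sum w Q - sum w ?U" using U assms(1) by (intro sum_diff) auto
  then have "1 \<le> sum w (Q - ?U)" using P(3) Suc.prems assms(3) by (simp add: algebra_simps)
  then obtain R where R: "R \<subseteq> Q - ?U" "1 \<le> sum w R" "sum w R \<le> 1 + \<delta>"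
    using ex_subset_sum_between[of "Q - ?U" w \<delta>] assms by auto
  define P' where "P' = P(Suc n := R)"
  have UN: "(\<Union>i\<in>{1..Suc n}. P' i) = ?U \<union> R"
    by (auto simp: P'_def atLeastAtMostSuc_conv)
  have "disjoint_family_on P' {1..Suc n}"
    using P(1) R(1) by (force simp: disjoint_family_on_def P'_def atLeastAtMostSuc_conv)
  moreover have "\<forall>i\<in>{1..Suc n}. P' i \<subseteq> Q \<and> 1 \<le> sum w (P' i)"
    using P(2) R by (auto simp: P'_def atLeastAtMostSuc_conv)
  moreover have "sum w (?U \<union> R) = sum w ?U + sum w R"
    using R U assms(1) by (intro sum.union_disjoint) (auto intro: finite_subset)
  then have "sum w (\<Union>i\<in>{1..Suc n}. P' i) \<le> (1 + \<delta>) * real (Suc n)"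
    unfolding UN using P(3) R(3) by (simp add: algebra_simps)
  ultimately show ?case by blast
qed

section \<open>Families without equal pairwise unions\<close>

text \<open>The dual of being sunflower-free, strengthened from distinct tuples to non-constant ones:
  unlike the former, this property passes to products of families on disjoint ground sets.\<close>
definition union_rigid :: "nat \<Rightarrow> 'a set set \<Rightarrow> bool" where
  "union_rigid k \<A> \<longleftrightarrow>
     (\<forall>X M. X ` {1..k} \<subseteq> \<A> \<and> (\<forall>i\<in>{1..k}. \<forall>j\<in>{1..k}. i \<noteq> j \<longrightarrow> X i \<union> X j = M) \<longrightarrow>
        (\<forall>i\<in>{1..k}. \<forall>j\<in>{1..k}. X i = X j))"

lemma union_rigidD:
  assumes "union_rigid k \<A>" "\<And>i. i \<in> {1..k} \<Longrightarrow> X i \<in> \<A>"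
    "\<And>i j. i \<in> {1..k} \<Longrightarrow> j \<in> {1..k} \<Longrightarrow> i \<noteq> j \<Longrightarrow> X i \<union> X j = M" "i \<in> {1..k}" "j \<in> {1..k}"
  shows "X i = X j"
proof -
  have "X ` {1..k} \<subseteq> \<A> \<and> (\<forall>i\<in>{1..k}. \<forall>j\<in>{1..k}. i \<noteq> j \<longrightarrow> X i \<union> X j = M)"
    using assms(2,3) by blast
  then show ?thesis
    using assms(1)[unfolded union_rigid_def, THEN spec[of _ X], THEN spec[of _ M]] assms(4,5) by blast
qed

text \<open>Complements turn constant unions into constant intersections, so sunflower-freeness
  makes two of the sets equal. Their union \<open>M\<close> is then that common set, and it contains
  all the others; having the same cardinality, they all equal \<open>M\<close>. This is why members
  of one size are taken.\<close>

lemma union_rigid_complements: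
  fixes \<F> :: "'a set set"
  assumes free: "sunflower_free k \<F>" and sub: "\<F> \<subseteq> Pow I" and fin: "finite I"
    and card: "\<And>T. T \<in> \<F> \<Longrightarrow> card T = s" and k: "k \<ge> 2"
  shows "union_rigid k ((\<lambda>T. I - T) ` \<F>)"
  unfolding union_rigid_def
proof (intro allI impI, elim conjE)
  fix X M
  assume X: "X ` {1..k} \<subseteq> (\<lambda>T. I - T) ` \<F>"
    and M: "\<forall>i\<in>{1..k}. \<forall>j\<in>{1..k}. i \<noteq> j \<longrightarrow> X i \<union> X j = M"
  define T where "T i = I - X i" for i
  have XI: "X i \<subseteq> I" and T: "T i \<in> \<F>" and cX: "card (X i) = card I - s" if "i \<in> {1..k}" for i
  proof -
    obtain U where U: "U \<in> \<F>" "X i = I - U" using X \<open>i \<in> {1..k}\<close> by blast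
    then have "U \<subseteq> I" using sub by blast
    then show "X i \<subseteq> I" "T i \<in> \<F>" "card (X i) = card I - s"
      using U card[OF U(1)] fin by (auto simp: T_def double_diff card_Diff_subset finite_subset)
  qed
  have inter: "T i \<inter> T j = I - M" if "i \<in> {1..k}" "j \<in> {1..k}" "i \<noteq> j" for i j
    using M that unfolding T_def by blast
  have "\<not> inj_on T {1..k}"
  proof
    assume "inj_on T {1..k}"
    moreover have "T i \<inter> T j = T 1 \<inter> T 2" if "1 \<le> i \<and> i < j \<and> j \<le> k" for i j
      using inter[of i j] inter[of 1 2] that k by auto
    ultimately have "is_sunflower k T" unfolding is_sunflower_def by blast
    moreover have "T ` {1..k} \<subseteq> \<F>" using T by blast
    ultimately show False using free unfolding sunflower_free_def by blast
  qed
  then obtain i j where ij: "i \<in> {1..k}" "j \<in> {1..k}" "i \<noteq> j" "T i = T j"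
    by (auto simp: inj_on_def)
  then have "X i = X j" using XI unfolding T_def by blast
  then have XM: "X i = M" using M ij by blast
  have "X l = M" if "l \<in> {1..k}" for l
  proof (rule card_subset_eq)
    show "X l \<subseteq> M" using M XM ij(1) that by (cases "l = i") blast+
    show "finite M" using XI[OF ij(1)] XM fin finite_subset by blast
    show "card (X l) = card M" using cX XM ij(1) that by metis
  qed
  then show "\<forall>i\<in>{1..k}. \<forall>j\<in>{1..k}. X i = X j" by blast
qed


section \<open>Transversals of disjoint groups\<close>

definition transversals :: "('i \<Rightarrow> 'a set) \<Rightarrow> 'i set set \<Rightarrow> 'a set set" where
  "transversals P \<G> = (\<lambda>(S, q). q ` S) ` (SIGMA S:\<G>. PiE S P)"

lemma transversalsE:
  assumes "X \<in> transversals P \<G>"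
  obtains S q where "S \<in> \<G>" "q \<in> PiE S P" "X = q ` S"
  using assms by (auto simp: transversals_def)

text \<open>Intersecting with the groups recovers both the index set and the choice function from
  the transversal alone.\<close>

lemma transversal_Int:
  assumes "disjoint_family_on P I" "S \<subseteq> I" "q \<in> PiE S P" "i \<in> I"
  shows "q ` S \<inter> P i = (if i \<in> S then {q i} else {})"
proof -
  have "j = i" if "j \<in> S" "q j \<in> P i" for j
    using assms that PiE_mem[OF assms(3) that(1)] unfolding disjoint_family_on_def by blast
  then show ?thesis using PiE_mem[OF assms(3)] by auto
qed

text \<open>Index sets come first: \<open>S l\<close> consists of the groups met by
  \<open>X l\<close>, so pairwise unions of the \<open>S l\<close> are the groups met by
  \<open>M\<close>, and rigidity of \<open>\<G>\<close> makes all \<open>S l\<close> equal. It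
  remains to compare the chosen points group by group.\<close>

lemma union_rigid_transversals:
  assumes disj: "disjoint_family_on P I" and G: "\<G> \<subseteq> Pow I" and rigid: "union_rigid k \<G>"
    and k: "k \<ge> 3"
  shows "union_rigid k (transversals P \<G>)"
  unfolding union_rigid_def
proof (intro allI impI, elim conjE)
  fix X M
  assume X: "X ` {1..k} \<subseteq> transversals P \<G>"
    and M: "\<forall>i\<in>{1..k}. \<forall>j\<in>{1..k}. i \<noteq> j \<longrightarrow> X i \<union> X j = M"
  have "\<forall>l\<in>{1..k}. \<exists>S q. S \<in> \<G> \<and> q \<in> PiE S P \<and> X l = q ` S"
  proof
    fix l assume "l \<in> {1..k}"
    then have "X l \<in> transversals P \<G>" using X by blast
    then show "\<exists>S q. S \<in> \<G> \<and> q \<in> PiE S P \<and> X l = q ` S" by (auto simp: transversals_def)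
  qed
  then obtain S q where Sq: "\<And>l. l \<in> {1..k} \<Longrightarrow> S l \<in> \<G>"
    "\<And>l. l \<in> {1..k} \<Longrightarrow> q l \<in> PiE (S l) P" "\<And>l. l \<in> {1..k} \<Longrightarrow> X l = q l ` S l"
    by metis
  have SI: "S l \<subseteq> I" if "l \<in> {1..k}" for l using Sq(1)[OF that] G by blast
  have XP: "X l \<inter> P i = (if i \<in> S l then {q l i} else {})" if "l \<in> {1..k}" "i \<in> I" for l i
    using transversal_Int[OF disj SI Sq(2)] Sq(3) that by simp
  have S_eq: "S l = {i \<in> I. X l \<inter> P i \<noteq> {}}" if "l \<in> {1..k}" for l
  proof -
    have "i \<in> S l \<longleftrightarrow> X l \<inter> P i \<noteq> {}" if "i \<in> I" for i using XP[OF \<open>l \<in> {1..k}\<close> that] by simp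
    then show ?thesis using SI[OF that] by blast
  qed
  have "S l \<union> S j = {i \<in> I. M \<inter> P i \<noteq> {}}" if "l \<in> {1..k}" "j \<in> {1..k}" "l \<noteq> j" for l j
  proof -
    have "M = X l \<union> X j" using M that by blast
    then show ?thesis unfolding S_eq[OF that(1)] S_eq[OF that(2)] by blast
  qed
  then have S_const: "S l = S j" if "l \<in> {1..k}" "j \<in> {1..k}" for l j
    using union_rigidD[OF rigid Sq(1), of "\<lambda>l. l"] that by blast
  \<comment> \<open>Two distinct points of one group cannot both lie in \<open>M\<close>: each is missing from at most
    one of the \<open>k \<ge> 3\<close> sets, so some set would contain both.\<close>
  have "X l \<subseteq> X j" if l: "l \<in> {1..k}" and j: "j \<in> {1..k}" for l j
  proof
    fix x assume "x \<in> X l"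
    then obtain i where i: "i \<in> S l" "x = q l i" using Sq(3)[OF l] by blast
    have iI: "i \<in> I" using SI[OF l] i by blast
    have XPi: "X h \<inter> P i = {q h i}" if "h \<in> {1..k}" for h
      using XP[OF that iI] S_const[OF that l] i by simp
    have uniq: "u = v" if "h \<in> {1..k}" "u \<in> X h" "u \<in> P i" "v \<in> X h" "v \<in> P i" for h u v
    proof -
      have "u \<in> {q h i}" "v \<in> {q h i}" using XPi[OF that(1)] that by blast+
      then show ?thesis by simp
    qed
    show "x \<in> X j"
    proof (rule ccontr)
      assume x: "x \<notin> X j"
      define y where "y = q j i"
      have mem: "x \<in> X l" "x \<in> P i" "y \<in> X j" "y \<in> P i"
        using XPi[OF l] XPi[OF j] i unfolding y_def by blast+
      have "x \<noteq> y" using x mem by blast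
      have "y \<notin> X l" using uniq[OF l] mem \<open>x \<noteq> y\<close> by metis
      have "l \<noteq> j" using x mem by blast
      have "\<not> {1..k} \<subseteq> {l, j}"
        using k card_mono[of "{l, j}" "{1..k}"] \<open>l \<noteq> j\<close> by auto
      then obtain h where h: "h \<in> {1..k}" "h \<noteq> l" "h \<noteq> j" by blast
      have "x \<in> M" "y \<in> M" using M l j \<open>l \<noteq> j\<close> mem by blast+
      moreover have "X h \<union> X j = M" "X h \<union> X l = M" using M l j h by blast+
      ultimately have "x \<in> X h" "y \<in> X h" using x \<open>y \<notin> X l\<close> by blast+
      then show False using uniq[OF h(1)] mem \<open>x \<noteq> y\<close> by metis
    qed
  qed
  then show "\<forall>i\<in>{1..k}. \<forall>j\<in>{1..k}. X i = X j" by blast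
qed

text \<open>Expanding the product of group sums gives one term per choice function. Disjointness
  ensures that different pairs \<open>(S, q)\<close> give different transversals and that no point
  is chosen twice.\<close>

lemma sum_prod_transversals:
  fixes w :: "'a \<Rightarrow> 'b::comm_semiring_1"
  assumes disj: "disjoint_family_on P I" and G: "\<G> \<subseteq> Pow I" and I: "finite I"
    and P: "\<And>i. i \<in> I \<Longrightarrow> finite (P i)"
  shows "(\<Sum>X\<in>transversals P \<G>. prod w X) = (\<Sum>S\<in>\<G>. \<Prod>i\<in>S. sum w (P i))"
proof -
  have Int: "q ` S \<inter> P i = (if i \<in> S then {q i} else {})"
    if "S \<in> \<G>" "q \<in> PiE S P" "i \<in> I" for S q i
    using that G by (intro transversal_Int[OF disj]) auto
  have inj: "inj_on (\<lambda>(S, q). q ` S) (SIGMA S:\<G>. PiE S P)"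
  proof (rule inj_onI, clarify)
    fix S q S' q'
    assume S: "S \<in> \<G>" "q \<in> PiE S P" and S': "S' \<in> \<G>" "q' \<in> PiE S' P" and eq: "q ` S = q' ` S'"
    have e: "(if i \<in> S then {q i} else {}) = (if i \<in> S' then {q' i} else {})" if "i \<in> I" for i
      using Int[OF S that] Int[OF S' that] eq by simp
    have sub: "S \<subseteq> I" "S' \<subseteq> I" using S S' G by auto
    have "i \<in> S \<longleftrightarrow> i \<in> S'" if "i \<in> I" for i using e[OF that] by (auto split: if_splits)
    then have "S = S'" using sub by blast
    moreover have "q i = q' i" if "i \<in> S" for i
      using e[of i] that sub \<open>S = S'\<close> by auto
    ultimately show "S = S' \<and> q = q'" using S(2) S'(2) by (auto intro: PiE_ext)
  qed
  have finS: "finite S" if "S \<in> \<G>" for S using that G I finite_subset by blast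
  have prod_eq: "prod w (q ` S) = (\<Prod>i\<in>S. w (q i))" if "S \<in> \<G>" "q \<in> PiE S P" for S q
  proof -
    have "inj_on q S"
    proof (rule inj_onI)
      fix i j assume ij: "i \<in> S" "j \<in> S" "q i = q j"
      then have "q i \<in> P i \<inter> P j"
        using PiE_mem[OF that(2) ij(1)] PiE_mem[OF that(2) ij(2)] by simp
      then show "i = j" using disj ij G that(1) unfolding disjoint_family_on_def by blast
    qed
    then show ?thesis by (simp add: prod.reindex)
  qed
  have "(\<Sum>X\<in>transversals P \<G>. prod w X) = (\<Sum>(S, q)\<in>(SIGMA S:\<G>. PiE S P). prod w (q ` S))"
    unfolding transversals_def by (subst sum.reindex[OF inj]) (auto intro: sum.cong)
  also have "\<dots> = (\<Sum>S\<in>\<G>. \<Sum>q\<in>PiE S P. prod w (q ` S))"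
    using G I P finS by (intro sum.Sigma[symmetric] ballI finite_PiE) (auto intro: finite_subset)
  also have "\<dots> = (\<Sum>S\<in>\<G>. \<Sum>q\<in>PiE S P. \<Prod>i\<in>S. w (q i))"
    by (intro sum.cong refl prod_eq) auto
  also have "\<dots> = (\<Sum>S\<in>\<G>. \<Prod>i\<in>S. sum w (P i))"
    using G P finS by (intro sum.cong refl prod_sum_PiE[symmetric]) auto
  finally show ?thesis .
qed

section \<open>Products over disjoint ground sets, iterated over blocks\<close>

text \<open>The traces on \<open>Q\<close> and on \<open>R\<close> again have constant pairwise
  unions, so each trace is constant. Distinct sets may share a trace, which is why rigidity is
  stated for arbitrary tuples.\<close>

lemma union_rigid_product:
  assumes A: "union_rigid k \<A>" "\<A> \<subseteq> Pow Q" and B: "union_rigid k \<B>" "\<B> \<subseteq> Pow R"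
    and QR: "Q \<inter> R = {}"
  shows "union_rigid k ((\<lambda>(X, Y). X \<union> Y) ` (\<A> \<times> \<B>))"
  unfolding union_rigid_def
proof (intro allI impI, elim conjE)
  fix Z M
  assume Z: "Z ` {1..k} \<subseteq> (\<lambda>(X, Y). X \<union> Y) ` (\<A> \<times> \<B>)"
    and M: "\<forall>i\<in>{1..k}. \<forall>j\<in>{1..k}. i \<noteq> j \<longrightarrow> Z i \<union> Z j = M"
  have Zi: "Z i \<inter> Q \<in> \<A>" "Z i \<inter> R \<in> \<B>" "Z i = (Z i \<inter> Q) \<union> (Z i \<inter> R)" if "i \<in> {1..k}" for i
  proof -
    have "Z i \<in> (\<lambda>(X, Y). X \<union> Y) ` (\<A> \<times> \<B>)" using Z \<open>i \<in> {1..k}\<close> by (meson image_subset_iff)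
    then obtain X Y where XY: "X \<in> \<A>" "Y \<in> \<B>" "Z i = X \<union> Y" by auto
    then have "Z i \<inter> Q = X" "Z i \<inter> R = Y" using A(2) B(2) QR by blast+
    then show "Z i \<inter> Q \<in> \<A>" "Z i \<inter> R \<in> \<B>" "Z i = (Z i \<inter> Q) \<union> (Z i \<inter> R)" using XY by auto
  qed
  have "Z i \<inter> Q = Z j \<inter> Q" if "i \<in> {1..k}" "j \<in> {1..k}" for i j
    using M by (intro union_rigidD[OF A(1), of "\<lambda>i. Z i \<inter> Q" "M \<inter> Q"] Zi that) blast+
  moreover have "Z i \<inter> R = Z j \<inter> R" if "i \<in> {1..k}" "j \<in> {1..k}" for i j
    using M by (intro union_rigidD[OF B(1), of "\<lambda>i. Z i \<inter> R" "M \<inter> R"] Zi that) blast+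
  ultimately show "\<forall>i\<in>{1..k}. \<forall>j\<in>{1..k}. Z i = Z j" using Zi(3) by metis
qed

lemma sum_prod_product:
  fixes w :: "'a \<Rightarrow> 'b::comm_semiring_1"
  assumes "\<A> \<subseteq> Pow Q" "\<B> \<subseteq> Pow R" "Q \<inter> R = {}" "finite Q" "finite R"
  shows "(\<Sum>Z\<in>(\<lambda>(X, Y). X \<union> Y) ` (\<A> \<times> \<B>). prod w Z) = (\<Sum>X\<in>\<A>. prod w X) * (\<Sum>Y\<in>\<B>. prod w Y)"
proof -
  have "inj_on (\<lambda>(X, Y). X \<union> Y) (\<A> \<times> \<B>)"
  proof (rule inj_onI, clarify)
    fix X Y X' Y' assume "X \<in> \<A>" "Y \<in> \<B>" "X' \<in> \<A>" "Y' \<in> \<B>" "X \<union> Y = X' \<union> Y'"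
    moreover from this have "X \<subseteq> Q" "X' \<subseteq> Q" "Y \<subseteq> R" "Y' \<subseteq> R" using assms by blast+
    ultimately show "X = X' \<and> Y = Y'" using assms(3) by blast
  qed
  then have "(\<Sum>Z\<in>(\<lambda>(X, Y). X \<union> Y) ` (\<A> \<times> \<B>). prod w Z) = (\<Sum>(X, Y)\<in>\<A> \<times> \<B>. prod w (X \<union> Y))"
    by (subst sum.reindex) (auto intro: sum.cong)
  also have "\<dots> = (\<Sum>(X, Y)\<in>\<A> \<times> \<B>. prod w X * prod w Y)"
  proof (intro sum.cong refl, clarify)
    fix X Y assume "X \<in> \<A>" "Y \<in> \<B>"
    then have "X \<subseteq> Q" "Y \<subseteq> R" using assms by blast+
    then show "prod w (X \<union> Y) = prod w X * prod w Y"
      using assms by (intro prod.union_disjoint) (auto intro: finite_subset)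
  qed
  also have "\<dots> = (\<Sum>X\<in>\<A>. prod w X) * (\<Sum>Y\<in>\<B>. prod w Y)"
    by (simp add: sum_product sum.cartesian_product)
  finally show ?thesis .
qed

text \<open>Each of the \<open>t\<close> blocks consumes at most \<open>(1 + \<delta>) * n\<close>
  of the weight and multiplies the total by at least \<open>card \<G>\<close>, because every
  \<open>S\<close> in \<open>\<G>\<close> contributes a product of group sums that are at least 1.
  The bound on \<open>card X\<close> later limits the size of the integers.\<close>

lemma ex_union_rigid_family_of_large_weight:
  fixes w :: "'a \<Rightarrow> real"
  assumes rigid: "union_rigid k \<G>" and G: "\<G> \<subseteq> Pow {1..n::nat}" and k: "k \<ge> 3" and d: "0 \<le> \<delta>"
    and "finite Q" "\<And>x. x \<in> Q \<Longrightarrow> 0 \<le> w x \<and> w x \<le> \<delta>" "(1 + \<delta>) * real (n * t) \<le> sum w Q"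
  shows "\<exists>\<A>\<subseteq>Pow Q. union_rigid k \<A> \<and> (\<forall>X\<in>\<A>. card X \<le> n * t) \<and>
           real (card \<G>) ^ t \<le> (\<Sum>X\<in>\<A>. prod w X)"
  using assms(5-)
proof (induction t arbitrary: Q)
  case 0
  have "union_rigid k {{}::'a set}" unfolding union_rigid_def by blast
  then show ?case by (intro exI[of _ "{{}}"]) auto
next
  case (Suc t)
  have "(1 + \<delta>) * real n \<le> (1 + \<delta>) * real (n * Suc t)"
    using d by (intro mult_left_mono) auto
  then have "(1 + \<delta>) * real n \<le> sum w Q" using Suc.prems(3) by linarith
  then obtain P where P: "disjoint_family_on P {1..n}"
    "\<forall>i\<in>{1..n}. P i \<subseteq> Q \<and> 1 \<le> sum w (P i)" "sum w (\<Union>i\<in>{1..n}. P i) \<le> (1 + \<delta>) * real n"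
    using ex_disjoint_subsets_sum_ge_1[of Q w \<delta> n] Suc.prems d by blast
  define U where "U = (\<Union>i\<in>{1..n}. P i)"
  have U: "U \<subseteq> Q" using P(2) unfolding U_def by blast
  then have finU: "finite U" using Suc.prems(1) finite_subset by blast
  have finP: "finite (P i)" if "i \<in> {1..n}" for i using P(2) that Suc.prems(1) finite_subset by blast
  have "sum w (Q - U) = sum w Q - sum w U" using U Suc.prems by (intro sum_diff) auto
  then have "(1 + \<delta>) * real (n * t) \<le> sum w (Q - U)"
    using P(3) Suc.prems(3) unfolding U_def by (simp add: algebra_simps)
  then obtain \<A> where A: "\<A> \<subseteq> Pow (Q - U)" "union_rigid k \<A>" "\<forall>X\<in>\<A>. card X \<le> n * t"
    "real (card \<G>) ^ t \<le> (\<Sum>X\<in>\<A>. prod w X)"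
    using Suc.IH[of "Q - U"] Suc.prems by auto
  define \<B> where "\<B> = transversals P \<G>"
  have B_sub: "\<B> \<subseteq> Pow U"
  proof
    fix X assume "X \<in> \<B>"
    then obtain S q where "S \<in> \<G>" "q \<in> PiE S P" "X = q ` S" unfolding \<B>_def by (rule transversalsE)
    then show "X \<in> Pow U" using G PiE_mem[of q S P] unfolding U_def by blast
  qed
  have B_card: "card X \<le> n" if "X \<in> \<B>" for X
  proof -
    obtain S q where S: "S \<in> \<G>" "X = q ` S" using \<open>X \<in> \<B>\<close> unfolding \<B>_def by (rule transversalsE)
    then have "S \<subseteq> {1..n}" using G by blast
    then have "finite S" "card S \<le> n" using card_mono[of "{1..n}" S] finite_subset by auto
    then show ?thesis using card_image_le[of S q] S(2) by simp
  qed
  have "(\<Sum>S\<in>\<G>. 1) \<le> (\<Sum>S\<in>\<G>. \<Prod>i\<in>S. sum w (P i))"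
    using P(2) G by (intro sum_mono prod_ge_1) blast
  also have "\<dots> = (\<Sum>X\<in>\<B>. prod w X)"
    unfolding \<B>_def using finP by (intro sum_prod_transversals[OF P(1) G, symmetric]) auto
  finally have B_sum: "real (card \<G>) \<le> (\<Sum>X\<in>\<B>. prod w X)" by simp
  define \<C> where "\<C> = (\<lambda>(X, Y). X \<union> Y) ` (\<A> \<times> \<B>)"
  have "union_rigid k \<C>"
    unfolding \<C>_def using A B_sub union_rigid_transversals[OF P(1) G rigid k] unfolding \<B>_def[symmetric]
    by (intro union_rigid_product[of k \<A> "Q - U" \<B> U]) auto
  moreover have "\<C> \<subseteq> Pow Q" using A(1) B_sub U unfolding \<C>_def by auto
  moreover have "\<forall>Z\<in>\<C>. card Z \<le> n * Suc t"
  proof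
    fix Z assume "Z \<in> \<C>"
    then obtain X Y where XY: "X \<in> \<A>" "Y \<in> \<B>" "Z = X \<union> Y" unfolding \<C>_def by auto
    then show "card Z \<le> n * Suc t"
      using card_Un_le[of X Y] A(3) B_card[of Y] by fastforce
  qed
  moreover have "real (card \<G>) ^ Suc t \<le> (\<Sum>Z\<in>\<C>. prod w Z)"
  proof -
    have "real (card \<G>) ^ Suc t = real (card \<G>) ^ t * real (card \<G>)" by (simp add: algebra_simps)
    also have "\<dots> \<le> (\<Sum>X\<in>\<A>. prod w X) * (\<Sum>X\<in>\<B>. prod w X)"
      using A(4) B_sum by (intro mult_mono) (auto intro: order_trans[OF _ A(4)])
    also have "\<dots> = (\<Sum>Z\<in>\<C>. prod w Z)"
      unfolding \<C>_def using A(1) B_sub finU Suc.prems(1)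
      by (intro sum_prod_product[of _ "Q - U" _ U, symmetric]) auto
    finally show ?thesis .
  qed
  ultimately show ?case by blast
qed


section \<open>LCM-free sets of squarefree numbers\<close>

lemma prime_factors_prod_primes:
  fixes X :: "nat set"
  assumes "finite X" "\<And>p. p \<in> X \<Longrightarrow> prime p"
  shows "prime_factors (\<Prod>X) = X"
proof -
  have "0 \<notin> (\<lambda>p. p) ` X" using assms(2)[of 0] by auto
  then have "prime_factors (\<Prod>X) = (\<Union>p\<in>X. prime_factors p)"
    using prime_factors_prod[of X "\<lambda>p. p"] assms(1) by simp
  also have "\<dots> = X" using assms(2) by (simp add: prime_prime_factors)
  finally show ?thesis .
qed

text \<open>On products of distinct primes, \<open>prime_factors\<close> inverts \<open>Prod\<close>
  and turns lcm into union. Equal pairwise lcms therefore become equal pairwise unions, and rigidity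
  contradicts the distinctness of the numbers.\<close>

lemma sum_prod_inverse_le_f_lcm:
  assumes k: "k \<ge> 2" and rigid: "union_rigid k \<A>"
    and fin: "\<And>X. X \<in> \<A> \<Longrightarrow> finite X" and prime: "\<And>X p. X \<in> \<A> \<Longrightarrow> p \<in> X \<Longrightarrow> prime p"
    and le: "\<And>X. X \<in> \<A> \<Longrightarrow> \<Prod>X \<le> N"
  shows "(\<Sum>X\<in>\<A>. \<Prod>p\<in>X. 1 / real p) \<le> f_lcm k N"
proof -
  let ?A = "Prod ` \<A>"
  have pf: "prime_factors (\<Prod>X) = X" if "X \<in> \<A>" for X
    using that by (intro prime_factors_prod_primes fin prime)
  have pos: "\<Prod>X > 0" if "X \<in> \<A>" for X
    using prime[OF that] prime_gt_0_nat by (intro prod_pos) auto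
  have inj: "inj_on Prod \<A>" by (rule inj_on_inverseI[of _ prime_factors]) (rule pf)
  have sub: "?A \<subseteq> {1..N}" using le pos by (auto simp: Suc_le_eq)
  have "lcm_free k ?A"
    unfolding lcm_free_def
  proof (intro notI, elim exE conjE)
    fix a m
    assume a: "inj_on a {1..k}" "a ` {1..k} \<subseteq> ?A"
      and m: "\<forall>i j. 1 \<le> i \<and> i < j \<and> j \<le> k \<longrightarrow> lcm (a i) (a j) = m"
    define X where "X i = prime_factors (a i)" for i
    have X: "X i \<in> \<A>" "a i = \<Prod>(X i)" "a i \<noteq> 0" if "i \<in> {1..k}" for i
    proof -
      obtain Y where "Y \<in> \<A>" "a i = \<Prod>Y" using a(2) \<open>i \<in> {1..k}\<close> by blast
      then show "X i \<in> \<A>" "a i = \<Prod>(X i)" "a i \<noteq> 0"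
        unfolding X_def using pf[of Y] pos[of Y] by auto
    qed
    have "X i \<union> X j = prime_factors m" if ij: "i \<in> {1..k}" "j \<in> {1..k}" "i \<noteq> j" for i j
    proof -
      have "lcm (a i) (a j) = m"
        using m[rule_format, of i j] m[rule_format, of j i] ij lcm.commute[of "a i" "a j"]
        by (cases i j rule: linorder_cases) auto
      then show ?thesis
        unfolding X_def using prime_factorization_lcm[of "a i" "a j"] X(3) ij by auto
    qed
    then have "X 1 = X 2" using k by (intro union_rigidD[OF rigid, of X]) (auto intro: X(1))
    then have "a 1 = a 2" using X(2)[of 1] X(2)[of 2] k by simp
    then show False using inj_onD[OF a(1), of 1 2] k by simp
  qed
  then have "(\<Sum>a\<in>?A. 1 / real a) \<le> f_lcm k N"
    unfolding f_lcm_def using k sub by (intro Max_ge f_lcm_candidates) auto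
  also have "(\<Sum>a\<in>?A. 1 / real a) = (\<Sum>X\<in>\<A>. \<Prod>p\<in>X. 1 / real p)"
    by (subst sum.reindex[OF inj]) (simp add: prod_dividef)
  finally show ?thesis .
qed

text \<open>The witness is the number 1, the product of the empty set. This settles nonpositive
  exponents in the theorem.\<close>

lemma one_le_f_lcm:
  assumes "k \<ge> 2" "N \<ge> 1"
  shows "1 \<le> f_lcm k N"
proof -
  have "union_rigid k {{}::nat set}" unfolding union_rigid_def by blast
  then show ?thesis using sum_prod_inverse_le_f_lcm[of k "{{}}" N] assms by simp
qed

lemma card_power_le_f_lcm:
  assumes rigid: "union_rigid k \<G>" and G: "\<G> \<subseteq> Pow {1..n}" and k: "k \<ge> 3"
    and d: "0 < \<delta>" "1 \<le> \<delta> * real K" and x: "x \<ge> 1"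
    and weight: "(1 + \<delta>) * real (n * t) \<le> ln (ln (real x + 1)) - 1 - real K"
    and N: "x ^ (n * t) \<le> N"
  shows "real (card \<G>) ^ t \<le> f_lcm k N"
proof -
  \<comment> \<open>Beyond \<open>K\<close> all reciprocals are at most \<open>\<delta>\<close>. The
    discarded primes cost at most \<open>K\<close>, bounding each reciprocal by 1; this is the term
    \<open>real K\<close> in \<open>weight\<close>.\<close>
  define Q where "Q = {p. prime p \<and> p \<le> x} - {1..K}"
  have finQ: "finite Q" by (simp add: Q_def)
  have bound: "0 \<le> 1 / real p \<and> 1 / real p \<le> \<delta>" if "p \<in> Q" for p
  proof -
    have "prime p" "K < p" using that prime_gt_0_nat[of p] by (auto simp: Q_def)
    then have "\<delta> * real K \<le> \<delta> * real p" using d by simp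
    then have "1 \<le> \<delta> * real p" using d by linarith
    then show ?thesis using \<open>K < p\<close> by (simp add: field_simps)
  qed
  have "(\<Sum>p | prime p \<and> p \<le> x. 1 / real p) \<le> (\<Sum>p\<in>Q \<union> {1..K}. 1 / real p)"
    by (intro sum_mono2) (auto simp: Q_def)
  also have "\<dots> = (\<Sum>p\<in>Q. 1 / real p) + (\<Sum>p=1..K. 1 / real p)"
    by (intro sum.union_disjoint finQ) (auto simp: Q_def)
  also have "(\<Sum>p=1..K. 1 / real p) \<le> (\<Sum>p=1..K. 1)" by (intro sum_mono) auto
  finally have "(1 + \<delta>) * real (n * t) \<le> (\<Sum>p\<in>Q. 1 / real p)"
    using sum_inverse_primes_ge[OF x] weight by simp
  then obtain \<A> where A: "\<A> \<subseteq> Pow Q" "union_rigid k \<A>" "\<forall>X\<in>\<A>. card X \<le> n * t"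
    "real (card \<G>) ^ t \<le> (\<Sum>X\<in>\<A>. \<Prod>p\<in>X. 1 / real p)"
    using ex_union_rigid_family_of_large_weight[where w = "\<lambda>p. 1 / real p", OF rigid G k _ finQ bound, of t] d
    by auto
  note A(4)
  also have "(\<Sum>X\<in>\<A>. \<Prod>p\<in>X. 1 / real p) \<le> f_lcm k N"
  proof (rule sum_prod_inverse_le_f_lcm)
    fix X assume X: "X \<in> \<A>"
    then have XQ: "X \<subseteq> Q" using A(1) by blast
    then show "finite X" using finQ finite_subset by blast
    show "prime p" if "p \<in> X" for p using that XQ by (auto simp: Q_def)
    have "\<Prod>X \<le> (\<Prod>p\<in>X. x)" using XQ by (intro prod_mono) (auto simp: Q_def)
    also have "\<dots> \<le> x ^ (n * t)" using A(3) X x by (simp add: power_increasing)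
    finally show "\<Prod>X \<le> N" using N by simp
  qed (use k A(2) in auto)
  finally show ?thesis .
qed

section \<open>The growth rate\<close>

text \<open>Pigeonhole over the \<open>n + 1\<close> possible sizes of a member of an extremal
  family, followed by complementation, which is injective.\<close>

lemma ex_union_rigid_family_F_sun_le:
  assumes "k \<ge> 2"
  shows "\<exists>\<G>\<subseteq>Pow {1..n}. union_rigid k \<G> \<and> F_sun k n \<le> (n + 1) * card \<G>"
proof -
  have "F_sun k n \<in> {card \<F> | \<F>. \<F> \<subseteq> Pow {1..n} \<and> sunflower_free k \<F>}"
    unfolding F_sun_def using sunflower_free_singleton[OF assms, of "{}::nat set"]
    by (intro Max_in F_sun_candidates_finite) blast
  then obtain \<F> where F: "\<F> \<subseteq> Pow {1..n}" "sunflower_free k \<F>" "F_sun k n = card \<F>" by auto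
  have finF: "finite \<F>" using F(1) finite_subset by blast
  define \<F>' where "\<F>' s = {T \<in> \<F>. card T = s}" for s
  have "\<exists>s\<in>{..n}. card \<F> \<le> (n + 1) * card (\<F>' s)"
  proof (rule ccontr)
    assume "\<not> ?thesis"
    then have "(\<Sum>s\<in>{..n}. (n + 1) * card (\<F>' s)) < (\<Sum>s\<in>{..n}. card \<F>)"
      by (intro sum_strict_mono) (auto simp: not_le)
    then have "(n + 1) * (\<Sum>s\<in>{..n}. card (\<F>' s)) < (n + 1) * card \<F>"
      by (simp add: sum_distrib_left)
    moreover have "\<F> \<subseteq> (\<Union>s\<in>{..n}. \<F>' s)"
    proof
      fix T assume "T \<in> \<F>"
      moreover from this have "card T \<le> n" using F(1) card_mono[of "{1..n}" T] by auto
      ultimately show "T \<in> (\<Union>s\<in>{..n}. \<F>' s)" by (auto simp: \<F>'_def)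
    qed
    then have "card \<F> \<le> card (\<Union>s\<in>{..n}. \<F>' s)"
      using finF by (intro card_mono) (auto simp: \<F>'_def)
    then have "card \<F> \<le> (\<Sum>s\<in>{..n}. card (\<F>' s))"
      using card_UN_le[of "{..n}" \<F>'] by simp
    then have "(n + 1) * card \<F> \<le> (n + 1) * (\<Sum>s\<in>{..n}. card (\<F>' s))" by (rule mult_le_mono2)
    ultimately show False by linarith
  qed
  then obtain s where s: "card \<F> \<le> (n + 1) * card (\<F>' s)" by blast
  define \<G> where "\<G> = (\<lambda>T. {1..n} - T) ` \<F>' s"
  have "sunflower_free k (\<F>' s)"
    using F(2) order_trans[of _ "\<F>' s" \<F>] unfolding sunflower_free_def \<F>'_def by blast
  then have "union_rigid k \<G>"
    unfolding \<G>_def using F(1) assms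
    by (intro union_rigid_complements[where s = s]) (auto simp: \<F>'_def)
  moreover have "card \<G> = card (\<F>' s)"
    unfolding \<G>_def using F(1) by (intro card_image) (auto simp: inj_on_def \<F>'_def)
  moreover have "\<G> \<subseteq> Pow {1..n}" unfolding \<G>_def by auto
  ultimately show ?thesis using s F(3) by metis
qed

text \<open>With \<open>\<beta>'\<close> strictly between \<open>\<beta>\<close> and the limsup,
  \<open>F_sun k n\<close> exceeds \<open>\<beta>' ^ n\<close> for infinitely many \<open>n\<close>.
  The loss of \<open>n + 1\<close> is absorbed because
  \<open>(n + 1) * (\<beta> / \<beta>') ^ n\<close> tends to 0.\<close>

lemma ex_union_rigid_family_power_le:
  assumes k: "k \<ge> 2" and b: "0 < \<beta>" "\<beta> < mu_sun k"
  shows "\<exists>n>0. \<exists>\<G>\<subseteq>Pow {1..n}. union_rigid k \<G> \<and> \<beta> ^ n \<le> real (card \<G>)"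
proof -
  obtain \<beta>' where b': "\<beta> < \<beta>'" "\<beta>' < mu_sun k" using b dense by blast
  define r where "r = \<beta> / \<beta>'"
  have r: "0 < r" "r < 1" using b b' by (auto simp: r_def)
  have "(\<lambda>n. real n * r ^ n + r ^ n) \<longlonglongrightarrow> 0 + 0"
    using r by (intro tendsto_add powser_times_n_limit_0 LIMSEQ_realpow_zero) auto
  then have "\<forall>\<^sub>F n in sequentially. real n * r ^ n + r ^ n < 1"
    by (intro order_tendstoD) auto
  then have ev: "\<forall>\<^sub>F n in sequentially. n > 0 \<and> real n * r ^ n + r ^ n < 1"
    using eventually_gt_at_top by (rule eventually_conj[rotated])
  have "\<exists>\<^sub>F n in sequentially. \<beta>' < root n (real (F_sun k n))"
  proof (rule ccontr)
    assume "\<not> ?thesis"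
    then have "limsup (\<lambda>n. ereal (root n (real (F_sun k n)))) \<le> ereal \<beta>'"
      by (intro Limsup_bounded) (simp add: not_frequently not_less)
    then show False using ereal_mu_sun[OF k] b'(2) by (metis ereal_less_eq(3) not_le)
  qed
  then obtain n where n: "\<beta>' < root n (real (F_sun k n))" "n > 0" "real n * r ^ n + r ^ n < 1"
    using frequently_ex[OF frequently_eventually_conj[OF _ ev]] by blast
  obtain \<G> where G: "\<G> \<subseteq> Pow {1..n}" "union_rigid k \<G>" "F_sun k n \<le> (n + 1) * card \<G>"
    using ex_union_rigid_family_F_sun_le[OF k, of n] by blast
  have "\<beta>' ^ n \<le> root n (real (F_sun k n)) ^ n" using n b b' by (intro power_mono) auto
  also have "\<dots> = real (F_sun k n)" using n by simp
  also have "\<dots> \<le> real ((n + 1) * card \<G>)" using G(3) by (rule of_nat_mono)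
  finally have F: "\<beta>' ^ n \<le> (real n + 1) * real (card \<G>)" by (simp add: algebra_simps)
  have "\<beta> ^ n * (real n + 1) = \<beta>' ^ n * (real n * r ^ n + r ^ n)"
    using b b' by (simp add: r_def power_divide field_simps)
  also have "\<dots> \<le> \<beta>' ^ n" using n b b' by (simp add: mult_le_cancel_left1)
  also note F
  finally have "\<beta> ^ n \<le> real (card \<G>)" by (simp add: mult.commute)
  then show ?thesis using G n by blast
qed

section \<open>Choice of parameters and conclusion\<close>

theorem theorem1p6:
  fixes k :: nat
  assumes "k \<ge> 3"
  shows "\<forall>\<epsilon>>0. \<forall>\<^sub>F N in sequentially.
           f_lcm k N \<ge> ln (real N) powr (ln (mu_sun k) - \<epsilon>)"
proof (intro allI impI)
  fix \<epsilon> :: real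
  assume "\<epsilon> > 0"
  note k = assms
  show "\<forall>\<^sub>F N in sequentially. f_lcm k N \<ge> ln (real N) powr (ln (mu_sun k) - \<epsilon>)"
  proof (cases "ln (mu_sun k) - \<epsilon> \<le> 0")
    case True
    show ?thesis
      using eventually_ge_at_top[of 3]
    proof eventually_elim
      case (elim N)
      have "exp 1 \<le> real N" using elim exp_le by linarith
      then have "1 \<le> ln (real N)" using elim by (simp add: ln_ge_iff)
      then have "ln (real N) powr (ln (mu_sun k) - \<epsilon>) \<le> ln (real N) powr 0"
        using True by (intro powr_mono) auto
      also have "\<dots> = 1" using \<open>1 \<le> ln (real N)\<close> by simp
      also have "1 \<le> f_lcm k N" using k elim by (intro one_le_f_lcm) auto
      finally show ?case .
    qed
  next
    case False
    \<comment> \<open>\<open>c\<close> is the target exponent. The slack of half an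
      \<open>\<epsilon>\<close> places \<open>exp b\<close> strictly below \<open>mu_sun k\<close>,
      so a family of size at least \<open>exp (b * n)\<close> exists for some
      \<open>n\<close>.\<close>
    define c where "c = ln (mu_sun k) - \<epsilon>"
    define b where "b = ln (mu_sun k) - \<epsilon> / 2"
    have c: "0 < c" "c < b" using False \<open>\<epsilon> > 0\<close> by (auto simp: c_def b_def)
    have "exp b < exp (ln (mu_sun k))" using \<open>\<epsilon> > 0\<close> by (simp add: b_def)
    also have "\<dots> = mu_sun k" using mu_sun_bounds(1)[of k] k by simp
    finally obtain n \<G> where n: "n > 0" and G: "\<G> \<subseteq> Pow {1..n}" "union_rigid k \<G>"
      "exp b ^ n \<le> real (card \<G>)"
      using ex_union_rigid_family_power_le[of k "exp b"] k by auto
    \<comment> \<open>About \<open>\<gamma> * ln (ln N)\<close> groups will be used: enough for the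
      exponent, as \<open>c < b * \<gamma>\<close>, yet leaving room in the prime sum, as
      \<open>\<gamma> < 1\<close>.\<close>
    obtain \<gamma> where g: "c / b < \<gamma>" "\<gamma> < 1" using c dense[of "c / b" 1] by auto
    then have g0: "0 < \<gamma>" and gc: "c < b * \<gamma>" using c by (auto simp: field_simps less_trans[OF _ g(1)])
    \<comment> \<open>\<open>\<delta>\<close> bounds both the overshoot of a group and the loss in
      the exponent of \<open>ln x\<close>. The quarter makes
      \<open>\<gamma> + 2 * \<delta> < 1\<close>, whence \<open>dg\<close>.\<close>
    define \<delta> where "\<delta> = (1 - \<gamma>) / 4"
    have d: "0 < \<delta>" using g by (simp add: \<delta>_def)
    have "\<delta> * \<gamma> \<le> \<delta>" using d g by simp
    moreover have "\<gamma> + 2 * \<delta> < 1" using g by (simp add: \<delta>_def field_simps)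
    ultimately have dg: "(1 + \<delta>) * \<gamma> < 1 - \<delta>" by (simp add: distrib_right)
    define K where "K = nat \<lceil>1 / \<delta>\<rceil>"
    have "1 / \<delta> \<le> real K" unfolding K_def by linarith
    then have K: "1 \<le> \<delta> * real K" using d by (simp add: field_simps)
    \<comment> \<open>Three requirements on \<open>L = ln (ln N)\<close> follow: the groups fit into
      the prime sum, rounding to whole blocks of \<open>n\<close> groups is harmless, and the number
      of groups is at most \<open>(ln N) powr \<delta>\<close>.\<close>
    have "\<forall>\<^sub>F L in at_top. (1 + \<delta>) * (\<gamma> * L) \<le> (1 - \<delta>) * L - 1 - real K"
    proof -
      have "\<forall>\<^sub>F L in at_top. (1 + real K) / (1 - \<delta> - (1 + \<delta>) * \<gamma>) \<le> L" by (rule eventually_ge_at_top)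
      then show ?thesis by eventually_elim (use dg in \<open>simp add: field_simps\<close>)
    qed
    moreover have "\<forall>\<^sub>F L in at_top. c * L \<le> b * (\<gamma> * L - real n)"
    proof -
      have "\<forall>\<^sub>F L in at_top. (b * real n) / (b * \<gamma> - c) \<le> L" by (rule eventually_ge_at_top)
      then show ?thesis by eventually_elim (use gc in \<open>simp add: field_simps\<close>)
    qed
    moreover have "\<forall>\<^sub>F L in at_top. L \<le> exp (\<delta> * L)"
    proof -
      have "\<forall>\<^sub>F L in at_top. 2 / \<delta>\<^sup>2 \<le> L" by (rule eventually_ge_at_top)
      then show ?thesis
        using eventually_ge_at_top[of 0]
      proof eventually_elim
        case (elim L)
        have "2 \<le> \<delta>\<^sup>2 * L" using elim d by (simp add: field_simps)
        then have "2 * L \<le> \<delta>\<^sup>2 * L * L" using elim(2) by (rule mult_right_mono)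
        then have "L \<le> (\<delta> * L)\<^sup>2 / 2" by (simp add: power2_eq_square algebra_simps)
        also have "\<dots> \<le> exp (\<delta> * L)"
          using exp_lower_Taylor_quadratic[of "\<delta> * L"] elim d by (smt (verit) mult_nonneg_nonneg)
        finally show ?case .
      qed
    qed
    moreover have "\<forall>\<^sub>F L in at_top. (0::real) < L" by (rule eventually_gt_at_top)
    ultimately have ev: "\<forall>\<^sub>F L in at_top. (1 + \<delta>) * (\<gamma> * L) \<le> (1 - \<delta>) * L - 1 - real K \<and>
        c * L \<le> b * (\<gamma> * L - real n) \<and> L \<le> exp (\<delta> * L) \<and> 0 < L"
      by eventually_elim blast
    have "filterlim (\<lambda>N. ln (ln (real N))) at_top sequentially"
      by (intro filterlim_compose[OF ln_at_top] filterlim_real_sequentially)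
    then have "\<forall>\<^sub>F N in sequentially. (1 + \<delta>) * (\<gamma> * ln (ln (real N))) \<le> (1 - \<delta>) * ln (ln (real N)) - 1 - real K \<and>
        c * ln (ln (real N)) \<le> b * (\<gamma> * ln (ln (real N)) - real n) \<and>
        ln (ln (real N)) \<le> exp (\<delta> * ln (ln (real N))) \<and> 0 < ln (ln (real N))"
      using eventually_compose_filterlim[OF ev] by blast
    then show ?thesis
      using eventually_ge_at_top[of 3]
    proof eventually_elim
      case (elim N)
      define L where "L = ln (ln (real N))"
      have "ln (real N) > 0" using elim(2) by simp
      then have expL: "exp L = ln (real N)" by (simp add: L_def)
      then have expexpL: "exp (exp L) = real N" using elim(2) by simp
      have L: "(1 + \<delta>) * (\<gamma> * L) \<le> (1 - \<delta>) * L - 1 - real K" "c * L \<le> b * (\<gamma> * L - real n)"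
        "L \<le> exp (\<delta> * L)" "0 < L"
        using elim(1) by (auto simp: L_def)
      define t where "t = nat \<lfloor>\<gamma> * L / real n\<rfloor>"
      have "0 \<le> \<gamma> * L / real n" using g0 L by simp
      then have "real t \<le> \<gamma> * L / real n" "\<gamma> * L / real n \<le> real t + 1" unfolding t_def by linarith+
      then have t: "real (n * t) \<le> \<gamma> * L" "\<gamma> * L - real n \<le> real (n * t)"
        using n by (auto simp: field_simps)
      \<comment> \<open>Here \<open>ln y = (ln N) powr (1 - \<delta>)\<close>. Rounding down gives
        \<open>y \<le> x + 1\<close>, which matches the \<open>x + 1\<close> in the bound for the
        prime sum.\<close>
      define y where "y = exp (exp ((1 - \<delta>) * L))"
      define x where "x = nat \<lfloor>y\<rfloor>"
      have "1 \<le> y" by (simp add: y_def)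
      then have x: "x \<ge> 1" "real x \<le> y" "y \<le> real x + 1" unfolding x_def by linarith+
      have "exp ((1 - \<delta>) * L) \<le> ln (real x + 1)"
        using x(3) by (simp add: ln_ge_iff y_def)
      moreover have "0 < ln (real x + 1)" using x(1) by simp
      ultimately have "(1 - \<delta>) * L \<le> ln (ln (real x + 1))" by (simp add: ln_ge_iff)
      moreover have "(1 + \<delta>) * real (n * t) \<le> (1 + \<delta>) * (\<gamma> * L)"
        using t(1) d by (intro mult_left_mono) auto
      ultimately have weight: "(1 + \<delta>) * real (n * t) \<le> ln (ln (real x + 1)) - 1 - real K"
        using L(1) by linarith
      have "\<gamma> * L \<le> L" using g L by simp
      then have nt: "real (n * t) \<le> exp (\<delta> * L)" using t(1) L(3) by linarith
      have "real x ^ (n * t) \<le> y ^ (n * t)" using x by (intro power_mono) auto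
      also have "\<dots> = exp (real (n * t) * exp ((1 - \<delta>) * L))"
        by (simp only: y_def exp_of_nat_mult)
      \<comment> \<open>The two exponents \<open>\<delta>\<close> and \<open>1 - \<delta>\<close>
        add up to 1, giving exactly \<open>exp (exp L) = N\<close>.\<close>
      also have "\<dots> \<le> exp (exp (\<delta> * L) * exp ((1 - \<delta>) * L))"
        using nt by (simp only: exp_le_cancel_iff) (intro mult_right_mono, auto)
      also have "\<dots> = real N" by (simp flip: exp_add expexpL add: algebra_simps)
      finally have "x ^ (n * t) \<le> N" by (simp flip: of_nat_power)
      then have "real (card \<G>) ^ t \<le> f_lcm k N"
        using card_power_le_f_lcm[OF G(2,1) k d K x(1) weight] by blast
      moreover have "ln (real N) powr c \<le> real (card \<G>) ^ t"
      proof -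
        have "ln (real N) powr c = exp (c * L)"
          using \<open>ln (real N) > 0\<close> by (simp add: powr_def L_def)
        also have "c * L \<le> b * real (n * t)"
          using L(2) t(2) c by (meson dual_order.trans less_imp_le less_trans mult_left_mono)
        then have "exp (c * L) \<le> exp (real (n * t) * b)" by (simp add: mult.commute)
        also have "\<dots> = (exp b ^ n) ^ t" by (simp only: exp_of_nat_mult power_mult)
        also have "\<dots> \<le> real (card \<G>) ^ t" using G(3) by (intro power_mono) auto
        finally show ?thesis .
      qed
      ultimately show ?case unfolding c_def by linarith
    qed
  qed
qed

end
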